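(* Let $s\geq 1$ and $n\geq 4^s$ be integers, and let $G$ be a graph of order $n$ with complement $\overline{G}$. Then \[ |\mu_{n-s+1}(G)|+|\mu_{n-s+1}(\overline{G})|\leq\frac{n}{\sqrt{2s}}+1. \]
   Context: Graphs are finite and simple. For a graph $G$ of order $n$, $\mu_1(G)\geq\mu_2(G)\geq\cdots\geq\mu_n(G)$ denote the eigenvalues of its adjacency matrix, and $\overline{G}$ denotes the complement of $G$. *)

theory Defs
  imports
    "Graph_Theory.Pair_Digraph"
    "Jordan_Normal_Form.Char_Poly"
begin

text \<open>
  A finite simple graph is a \<^locale>\<open>pair_graph\<close>: a finite vertex set together with an
  irreflexive, symmetric set of ordered pairs of vertices.
\<close>

definition complement_graph :: "'a pair_pre_digraph \<Rightarrow> 'a pair_pre_digraph" where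
  "complement_graph G =
     \<lparr> pverts = pverts G,
       parcs = {(u, v). u \<in> pverts G \<and> v \<in> pverts G \<and> u \<noteq> v \<and> (u, v) \<notin> parcs G} \<rparr>"

lemma pair_graph_complement_graph:
  assumes "pair_graph G"
  shows "pair_graph (complement_graph G)"
proof -
  interpret pair_graph G by fact
  have fin: "finite (parcs (complement_graph G))"
    by (rule finite_subset[of _ "pverts G \<times> pverts G"])
      (auto simp: complement_graph_def pair_finite_verts)
  have "sym (parcs G)"
    using pair_sym_arcs by (simp add: symmetric_def)
  then have "sym (parcs (complement_graph G))"
    by (auto simp: sym_def complement_graph_def)
  with fin show ?thesis
    by unfold_locales
      (auto simp: complement_graph_def pair_finite_verts symmetric_def)
qed

definition adjacency_mat_wrt :: "'a list \<Rightarrow> 'a pair_pre_digraph \<Rightarrow> real mat" where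
  "adjacency_mat_wrt vs G =
     mat (length vs) (length vs) (\<lambda>(i, j). if (vs ! i, vs ! j) \<in> parcs G then 1 else 0)"

lemma similar_adjacency_mat_wrt:
  assumes vs: "distinct vs" and ws: "distinct ws" and eq: "set vs = set ws"
  shows "similar_mat (adjacency_mat_wrt vs G) (adjacency_mat_wrt ws G)"
proof -
  define n where "n = length vs"
  have n': "length ws = n"
    using vs ws eq by (metis distinct_card n_def)
  define P where "P = (mat n n (\<lambda>(i, j). if vs ! i = ws ! j then 1 else 0) :: real mat)"
  define Q where "Q = (mat n n (\<lambda>(i, j). if ws ! i = vs ! j then 1 else 0) :: real mat)"
  let ?A = "adjacency_mat_wrt vs G" and ?B = "adjacency_mat_wrt ws G"
  have carr: "P \<in> carrier_mat n n" "Q \<in> carrier_mat n n"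
    "?A \<in> carrier_mat n n" "?B \<in> carrier_mat n n"
    by (auto simp: P_def Q_def adjacency_mat_wrt_def n' n_def)
  have idx_ws: "\<exists>k<n. vs ! i = ws ! k" if "i < n" for i
    using that eq n' n_def by (metis in_set_conv_nth nth_mem)
  have idx_vs: "\<exists>k<n. ws ! i = vs ! k" if "i < n" for i
    using that eq n' n_def by (metis in_set_conv_nth nth_mem)
  have inj: "vs ! i = vs ! j \<longleftrightarrow> i = j" "ws ! i = ws ! j \<longleftrightarrow> i = j"
    if "i < n" "j < n" for i j
    using that vs ws n' n_def by (auto simp: nth_eq_iff_index_eq)
  have pick: "(\<Sum>k\<in>{0..<n}. f k * (if k = m then 1 else 0)) = f m"
             "(\<Sum>k\<in>{0..<n}. (if m = k then 1 else 0) * f k) = f m"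
    if "m < n" for f :: "nat \<Rightarrow> real" and m
    using that by (auto simp: if_distrib[of "\<lambda>x. _ * x"] if_distrib[of "\<lambda>x. x * _"] cong: if_cong)
  have PQ: "P * Q = 1\<^sub>m n"
  proof (rule eq_matI)
    fix i j assume ij: "i < dim_row (1\<^sub>m n :: real mat)" "j < dim_col (1\<^sub>m n :: real mat)"
    then have ij': "i < n" "j < n" by auto
    obtain m where m: "m < n" "vs ! i = ws ! m" using idx_ws[OF ij'(1)] by blast
    have "(P * Q) $$ (i, j) = (\<Sum>k\<in>{0..<n}. (if m = k then 1 else 0) * (if ws ! k = vs ! j then 1 else 0))"
      using ij' m inj by (auto simp: P_def Q_def scalar_prod_def intro!: sum.cong)
    also have "\<dots> = (if ws ! m = vs ! j then 1 else 0)"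
      by (rule pick(2)[OF m(1)])
    finally show "(P * Q) $$ (i, j) = 1\<^sub>m n $$ (i, j)"
      using ij' m inj by (metis index_one_mat(1))
  qed (auto simp: P_def Q_def)
  have QP: "Q * P = 1\<^sub>m n"
    using mat_mult_left_right_inverse[OF carr(1,2) PQ] .
  have "?A * P = P * ?B"
  proof (rule eq_matI)
    fix i j assume "i < dim_row (P * ?B)" "j < dim_col (P * ?B)"
    then have ij: "i < n" "j < n" using carr by auto
    obtain m where m: "m < n" "vs ! i = ws ! m" using idx_ws[OF ij(1)] by blast
    obtain l where l: "l < n" "ws ! j = vs ! l" using idx_vs[OF ij(2)] by blast
    have "(?A * P) $$ (i, j) =
        (\<Sum>k\<in>{0..<n}. (if (vs ! i, vs ! k) \<in> parcs G then 1 else 0) * (if k = l then 1 else 0))"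
      using ij l inj n_def
      by (auto simp: P_def adjacency_mat_wrt_def scalar_prod_def intro!: sum.cong)
    also have "\<dots> = (if (vs ! i, vs ! l) \<in> parcs G then 1 else 0)"
      by (rule pick(1)[OF l(1)])
    also have "\<dots> = (if (ws ! m, ws ! j) \<in> parcs G then 1 else 0)"
      using m l by simp
    also have "\<dots> = (\<Sum>k\<in>{0..<n}. (if m = k then 1 else 0) * (if (ws ! k, ws ! j) \<in> parcs G then 1 else 0))"
      by (rule pick(2)[OF m(1), symmetric])
    also have "\<dots> = (P * ?B) $$ (i, j)"
      using ij m inj n'
      by (auto simp: P_def adjacency_mat_wrt_def scalar_prod_def intro!: sum.cong)
    finally show "(?A * P) $$ (i, j) = (P * ?B) $$ (i, j)" .
  qed (use carr in auto)
  then have "P * ?B * Q = ?A * P * Q" by simp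
  also have "\<dots> = ?A"
    using carr PQ by (simp add: assoc_mult_mat[OF carr(3) carr(1) carr(2)])
  finally have "?A = P * ?B * Q" by simp
  then show ?thesis
    using carr PQ QP by (intro similar_matI[of _ _ P Q n]) auto
qed

definition vertex_enum :: "'a pair_pre_digraph \<Rightarrow> 'a list" where
  "vertex_enum G = (SOME vs. distinct vs \<and> set vs = pverts G)"

lemma vertex_enum:
  assumes "finite (pverts G)"
  shows "distinct (vertex_enum G)" and "set (vertex_enum G) = pverts G"
    and "length (vertex_enum G) = card (pverts G)"
proof -
  have "\<exists>vs. distinct vs \<and> set vs = pverts G"
    using finite_distinct_list[OF assms] by blast
  then have "distinct (vertex_enum G) \<and> set (vertex_enum G) = pverts G"
    unfolding vertex_enum_def by (rule someI_ex)
  then show "distinct (vertex_enum G)" "set (vertex_enum G) = pverts G"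
    "length (vertex_enum G) = card (pverts G)"
    by (auto simp: distinct_card[symmetric])
qed

definition adjacency_mat :: "'a pair_pre_digraph \<Rightarrow> real mat" where
  "adjacency_mat G = adjacency_mat_wrt (vertex_enum G) G"

lemma adjacency_mat_carrier:
  assumes "finite (pverts G)"
  shows "adjacency_mat G \<in> carrier_mat (card (pverts G)) (card (pverts G))"
  using vertex_enum(3)[OF assms] by (auto simp: adjacency_mat_def adjacency_mat_wrt_def)

text \<open>The characteristic polynomial does not depend on the chosen enumeration of the vertices.\<close>

lemma char_poly_adjacency_mat:
  assumes "finite (pverts G)" and "distinct vs" and "set vs = pverts G"
  shows "char_poly (adjacency_mat G) = char_poly (adjacency_mat_wrt vs G)"
  unfolding adjacency_mat_def
  by (intro char_poly_similar similar_adjacency_mat_wrt) (use assms vertex_enum[of G] in auto)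

text \<open>
  The multiset of real roots of the characteristic polynomial, counted with algebraic
  multiplicity, in non-increasing order. As the adjacency matrix of a graph is symmetric,
  this list contains all eigenvalues; see lemma \<open>length_graph_spectrum\<close> below.
\<close>

definition graph_spectrum :: "'a pair_pre_digraph \<Rightarrow> real list" where
  "graph_spectrum G = rev (sorted_list_of_multiset (proots (char_poly (adjacency_mat G))))"

text \<open>Eigenvalues are numbered from 1, list positions from 0.\<close>

definition graph_eigenvalue :: "nat \<Rightarrow> 'a pair_pre_digraph \<Rightarrow> real" (\<open>\<mu>\<^bsub>_\<^esub>\<close>) where
  "\<mu>\<^bsub>k\<^esub> G = graph_spectrum G ! (k - 1)"

lemma symmetric_eigenvalue_real:
  fixes A :: "real mat"
  assumes A: "A \<in> carrier_mat n n"
    and sym: "\<And>i j. i < n \<Longrightarrow> j < n \<Longrightarrow> A $$ (i, j) = A $$ (j, i)"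
    and root: "poly (char_poly (map_mat complex_of_real A)) a = 0"
  shows "a \<in> \<real>"
proof -
  let ?C = "map_mat complex_of_real A"
  have C: "?C \<in> carrier_mat n n" using A by simp
  from root have "eigenvalue ?C a"
    using eigenvalue_root_char_poly[OF C] by simp
  then obtain v where v: "v \<in> carrier_vec n" "v \<noteq> 0\<^sub>v n" and Cv: "?C *\<^sub>v v = a \<cdot>\<^sub>v v"
    using C unfolding eigenvalue_def eigenvector_def by auto
  have row: "(\<Sum>j<n. of_real (A $$ (i, j)) * v $ j) = a * v $ i" if i: "i < n" for i
  proof -
    have "(\<Sum>j<n. of_real (A $$ (i, j)) * v $ j) = (?C *\<^sub>v v) $ i"
      using A v(1) i by (auto simp: scalar_prod_def lessThan_atLeast0 intro!: sum.cong)
    then show ?thesis using Cv v(1) i by simp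
  qed
  define S where "S = (\<Sum>i<n. cnj (v $ i) * v $ i)"
  define T where "T = (\<Sum>i<n. \<Sum>j<n. cnj (v $ i) * of_real (A $$ (i, j)) * v $ j)"
  have T: "T = a * S"
  proof -
    have "T = (\<Sum>i<n. cnj (v $ i) * (\<Sum>j<n. of_real (A $$ (i, j)) * v $ j))"
      by (simp add: T_def sum_distrib_left mult.assoc)
    also have "\<dots> = (\<Sum>i<n. cnj (v $ i) * (a * v $ i))"
      using row by simp
    finally show ?thesis by (simp add: S_def sum_distrib_left mult_ac)
  qed
  have "cnj T = (\<Sum>i<n. \<Sum>j<n. v $ i * of_real (A $$ (i, j)) * cnj (v $ j))"
    by (simp add: T_def)
  also have "\<dots> = (\<Sum>j<n. \<Sum>i<n. v $ i * of_real (A $$ (i, j)) * cnj (v $ j))"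
    by (rule sum.swap)
  also have "\<dots> = T"
    unfolding T_def using sym by (intro sum.cong) (auto simp: mult_ac)
  finally have T': "cnj T = T" .
  have S: "S = of_real (\<Sum>i<n. (cmod (v $ i))\<^sup>2)"
    unfolding S_def by (simp add: complex_norm_square mult.commute del: of_real_power)
  obtain i where i: "i < n" "v $ i \<noteq> 0"
    using v by (metis carrier_vecD eq_vecI index_zero_vec)
  have "(\<Sum>i<n. (cmod (v $ i))\<^sup>2) > 0"
    by (rule sum_pos2[of _ i]) (use i in auto)
  then have "S \<noteq> 0" and "cnj S = S"
    unfolding S by (simp_all only: of_real_eq_0_iff complex_cnj_complex_of_real)
  with T T' have "cnj a = a" by (metis complex_cnj_mult mult_right_cancel)
  then show ?thesis by (simp add: Reals_cnj_iff)
qed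

lemma length_graph_spectrum:
  assumes "pair_graph G"
  shows "length (graph_spectrum G) = card (pverts G)"
proof -
  interpret pair_graph G by fact
  define n where "n = card (pverts G)"
  define A where "A = adjacency_mat G"
  have A: "A \<in> carrier_mat n n"
    unfolding A_def n_def by (rule adjacency_mat_carrier[OF pair_finite_verts])
  have "sym (parcs G)"
    using pair_sym_arcs by (simp add: symmetric_def)
  then have sym: "A $$ (i, j) = A $$ (j, i)" if "i < n" "j < n" for i j
    using that vertex_enum(3)[OF pair_finite_verts]
    by (auto simp: A_def n_def adjacency_mat_def adjacency_mat_wrt_def sym_def)
  have C: "map_mat complex_of_real A \<in> carrier_mat n n" using A by simp
  obtain as where as: "char_poly (map_mat complex_of_real A) = (\<Prod>a\<leftarrow>as. [:- a, 1:])"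
    and len: "length as = n"
    using char_poly_factorized[OF C] by blast
  have real: "a \<in> \<real>" if "a \<in> set as" for a
  proof (rule symmetric_eigenvalue_real[OF A sym])
    show "poly (char_poly (map_mat complex_of_real A)) a = 0"
      unfolding as using that by (auto simp: poly_prod_list prod_list_zero_iff)
  qed
  define bs where "bs = map Re as"
  have as_bs: "as = map complex_of_real bs"
    unfolding bs_def using real by (auto simp: o_def intro!: map_idI[symmetric])
  have "map_poly complex_of_real (char_poly A) = (\<Prod>a\<leftarrow>as. [:- a, 1:])"
    unfolding of_real_hom.char_poly_hom[OF A, symmetric] by (rule as)
  also have "\<dots> = map_poly complex_of_real (\<Prod>b\<leftarrow>bs. [:- b, 1:])"
    unfolding as_bs
    by (induction bs) (auto simp: poly_eq_iff coeff_map_poly coeff_pCons split: nat.splits)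
  finally have "char_poly A = (\<Prod>b\<leftarrow>bs. [:- b, 1:])"
    by (simp add: poly_eq_iff coeff_map_poly)
  moreover have "proots (\<Prod>b\<leftarrow>bs. [:- b, 1:]) = mset bs"
  proof (induction bs)
    case (Cons b bs)
    have "(\<Prod>b\<leftarrow>bs. [:- b, 1:]) \<noteq> 0" by (auto simp: prod_list_zero_iff)
    then have "proots ([:- b, 1:] * (\<Prod>b\<leftarrow>bs. [:- b, 1:])) = {#b#} + mset bs"
      using Cons by (subst proots_mult) auto
    then show ?case by simp
  qed simp
  ultimately have "proots (char_poly A) = mset bs" by simp
  then show ?thesis
    using len size_mset[of "sorted_list_of_multiset (mset bs)"]
    by (simp add: graph_spectrum_def A_def[symmetric] n_def bs_def)
qed

end

theory Submission
  imports Defs "Jordan_Normal_Form.Schur_Decomposition" "HOL-Analysis.Convex"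
begin

text \<open>
  Let \<open>A\<close>, \<open>B\<close> be the adjacency matrices of \<open>G\<close> and its complement, let \<open>J\<close> be the all-ones matrix
  and \<open>M = 2A - J = J - 2I - 2B\<close>, a matrix with entries \<open>\<plusminus>1\<close>. Let \<open>P\<close> and \<open>Q\<close> be the orthogonal
  projections onto the spans of eigenvectors for the \<open>s\<close> smallest eigenvalues of \<open>A\<close> and \<open>B\<close>, and
  \<open>\<theta>\<close>, \<open>\<theta>'\<close> the largest of these eigenvalues. As \<open>J\<close> is positive semidefinite,
  \<open>\<langle>M, P\<rangle> \<le> 2s\<theta>\<close> and \<open>\<langle>M, Q\<rangle> \<ge> s(-2 - 2\<theta>')\<close>, while
  \<open>\<parallel>Q - P\<parallel>\<^sup>2 = 2s - 2 tr(PQ) \<le> 2s\<close> and \<open>\<parallel>M\<parallel> = n\<close> in the Frobenius norm. Cauchy-Schwarz gives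
  \<open>-\<theta> - \<theta>' - 1 \<le> n / sqrt (2s)\<close>. Finally \<open>\<theta>\<close> and \<open>\<theta>'\<close> are nonpositive: since \<open>n \<ge> 4^s\<close>, Ramsey's
  theorem provides a clique or an independent set of size \<open>s + 1\<close>.
\<close>

section \<open>Orthogonal diagonalisation of real symmetric matrices\<close>

text \<open>As many roots as the degree leave no room for a nonlinear factor; the induction divides
  out one linear factor per listed root. This turns a spectrum given as a multiset of roots into the
  factorisation that the diagonalisation takes as input.\<close>

lemma monic_eq_prod_list_proots:
  fixes p :: "'a :: idom poly"
  assumes "lead_coeff p = 1" and "mset xs = proots p" and "length xs = degree p"
  shows "p = (\<Prod>a\<leftarrow>xs. [:- a, 1:])"
  using assms
proof (induction xs arbitrary: p)
  case Nil
  then show ?case by (auto elim: degree_eq_zeroE)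
next
  case (Cons a xs)
  have p0: "p \<noteq> 0" using Cons.prems(1) by auto
  have "a \<in># proots p" using Cons.prems(2)[symmetric] by simp
  then have "poly p a = 0" using p0 by simp
  then obtain q where q: "p = [:- a, 1:] * q"
    unfolding poly_eq_0_iff_dvd by (elim dvdE)
  have q0: "q \<noteq> 0" using p0 q by auto
  have "proots p = {#a#} + proots q"
    unfolding q using q0 by (subst proots_mult) auto
  moreover have "degree p = Suc (degree q)"
    unfolding q using q0 by (subst degree_mult_eq) auto
  moreover have "lead_coeff q = 1"
    using Cons.prems(1) unfolding q lead_coeff_mult by simp
  ultimately have "q = (\<Prod>a\<leftarrow>xs. [:- a, 1:])"
    using Cons.prems by (intro Cons.IH) auto
  then show ?case using q by simp
qed

text \<open>Complete \<open>v\<close> to a basis and orthogonalise: Gram-Schmidt leaves the first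
  vector alone, and normalising only rescales it. The scalar \<open>c\<close> is the reciprocal of
  the length of \<open>v\<close>.\<close>

lemma orthogonal_mat_with_first_col:
  fixes v :: "real vec"
  assumes v: "v \<in> carrier_vec n" and v0: "v \<noteq> 0\<^sub>v n" and n: "0 < n"
  obtains W c where "W \<in> carrier_mat n n" and "W\<^sup>T * W = 1\<^sub>m n" and "col W 0 = c \<cdot>\<^sub>v v"
proof -
  interpret cof_vec_space n "TYPE(real)" .
  define b where "b = basis_completion v"
  from basis_completion[OF v v0, folded b_def]
  have dist_b: "distinct b" and indep: "\<not> lin_dep (set b)" and b: "set b \<subseteq> carrier_vec n"
    and hdb: "hd b = v" and len_b: "length b = n" by auto
  define ws where "ws = gram_schmidt n b"
  from gram_schmidt_result[OF b dist_b indep refl, folded ws_def]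
  have ws: "set ws \<subseteq> carrier_vec n" "corthogonal ws" "length ws = n"
    by (auto simp: len_b)
  obtain vs where bv: "b = v # vs" using hdb len_b n by (cases b) auto
  have ws0: "ws ! 0 = v"
    using gram_schmidt_hd[OF v, of vs] ws(3) n
    by (cases ws) (auto simp: ws_def bv)
  have carr: "ws ! i \<in> carrier_vec n" if "i < n" for i using ws that by auto
  have conj: "conjugate x = x" for x :: "real vec" by (rule eq_vecI) auto
  have orth: "ws ! i \<bullet> ws ! j = 0 \<longleftrightarrow> i \<noteq> j" if "i < n" "j < n" for i j
    using corthogonalD[OF ws(2), of i j] that ws(3) conj by simp
  define r where "r i = sqrt (ws ! i \<bullet> ws ! i)" for i
  have sq: "ws ! i \<bullet> ws ! i = r i * r i" "r i \<noteq> 0" if "i < n" for i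
  proof -
    have "0 \<le> ws ! i \<bullet> ws ! i"
      unfolding scalar_prod_def by (rule sum_nonneg) simp
    moreover have "ws ! i \<bullet> ws ! i \<noteq> 0" using orth[OF that that] by simp
    ultimately show "ws ! i \<bullet> ws ! i = r i * r i" "r i \<noteq> 0"
      by (auto simp: r_def)
  qed
  define W where "W = mat n n (\<lambda>(i, j). ws ! j $ i / r j)"
  have W: "W \<in> carrier_mat n n" by (simp add: W_def)
  have colW: "col W j = (1 / r j) \<cdot>\<^sub>v (ws ! j)" if "j < n" for j
    by (rule eq_vecI) (use that carr[OF that] in \<open>auto simp: W_def\<close>)
  have "W\<^sup>T * W = 1\<^sub>m n"
  proof (rule eq_matI)
    fix i j assume "i < dim_row (1\<^sub>m n :: real mat)" "j < dim_col (1\<^sub>m n :: real mat)"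
    then have ij: "i < n" "j < n" by auto
    have "(W\<^sup>T * W) $$ (i, j) = col W i \<bullet> col W j"
      using ij W by simp
    also have "\<dots> = (1 / r i) * ((1 / r j) * (ws ! i \<bullet> ws ! j))"
      using carr[OF ij(1)] carr[OF ij(2)] unfolding colW[OF ij(1)] colW[OF ij(2)]
      by (simp add: smult_scalar_prod_distrib[of _ n] scalar_prod_smult_distrib[of _ n])
    also have "\<dots> = (if i = j then 1 else 0)"
      using orth[OF ij] sq[OF ij(1)] by auto
    finally show "(W\<^sup>T * W) $$ (i, j) = 1\<^sub>m n $$ (i, j)" using ij by simp
  qed (use W in auto)
  then show thesis using that[OF W _ colW[OF n, unfolded ws0]] by simp
qed

text \<open>Deflation by induction on the list of roots: an orthogonal change of basis splits off
  one eigenvector, and symmetry leaves a smaller symmetric block with the remaining roots. The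
  diagonal keeps the order of \<open>as\<close>, so eigenvectors can later be addressed by their
  position in the spectrum.\<close>

lemma symmetric_mat_diagonalisation:
  fixes A :: "real mat"
  assumes "A \<in> carrier_mat n n" and "A\<^sup>T = A"
    and "char_poly A = (\<Prod>a\<leftarrow>as. [:- a, 1:])"
  shows "\<exists>P \<in> carrier_mat n n. P\<^sup>T * P = 1\<^sub>m n \<and>
    A = P * mat n n (\<lambda>(i, j). if i = j then as ! i else 0) * P\<^sup>T"
  using assms
proof (induction as arbitrary: n A)
  case Nil
  then have "n = 0" using degree_monic_char_poly[of A n] by simp
  then show ?case using Nil(1) by (intro bexI[of _ "1\<^sub>m 0"]) auto
next
  case (Cons a as n A)
  note A = Cons.prems(1) and sym = Cons.prems(2)
  have cp: "char_poly A = [:- a, 1:] * (\<Prod>a\<leftarrow>as. [:- a, 1:])"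
    using Cons.prems(3) by simp
  have "(\<Prod>a\<leftarrow>as. [:- a, 1:]) \<noteq> 0" by (auto simp: prod_list_zero_iff)
  then have "degree (char_poly A) = Suc (degree (\<Prod>a\<leftarrow>as. [:- a, 1:]))"
    unfolding cp by (subst degree_mult_eq) auto
  then obtain m where n: "n = Suc m" using degree_monic_char_poly[OF A] by auto
  have "eigenvalue A a" unfolding eigenvalue_root_char_poly[OF A] cp by simp
  then obtain v where v: "v \<in> carrier_vec n" "v \<noteq> 0\<^sub>v n" "A *\<^sub>v v = a \<cdot>\<^sub>v v"
    using A unfolding eigenvalue_def eigenvector_def by auto
  obtain W c where W: "W \<in> carrier_mat n n" and WW: "W\<^sup>T * W = 1\<^sub>m n"
    and W0: "col W 0 = c \<cdot>\<^sub>v v"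
    using orthogonal_mat_with_first_col[OF v(1,2)] n by blast
  have WT: "W\<^sup>T \<in> carrier_mat n n" using W by simp
  have WW': "W * W\<^sup>T = 1\<^sub>m n" using mat_mult_left_right_inverse[OF WT W WW] .
  define B where "B = W\<^sup>T * A * W"
  have B: "B \<in> carrier_mat n n" using W A by (simp add: B_def)
  have Bsym: "B\<^sup>T = B"
    unfolding B_def using W A sym
    by (simp add: transpose_mult[of _ n n _ n] assoc_mult_mat[of _ n n _ n _ n])
  have AB: "A = W * B * W\<^sup>T"
  proof -
    have "W * B * W\<^sup>T = (W * W\<^sup>T) * A * (W * W\<^sup>T)"
      unfolding B_def using W A WT by (simp add: assoc_mult_mat[of _ n n _ n _ n])
    then show ?thesis using A WW' by simp
  qed
  have "similar_mat A B"
    by (rule similar_matI[of _ _ W "W\<^sup>T" n]) (use A B W WT WW WW' AB in auto)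
  then have cpB: "char_poly B = [:- a, 1:] * (\<Prod>a\<leftarrow>as. [:- a, 1:])"
    using char_poly_similar cp by metis
  \<comment> \<open>The first column of \<open>W\<close> is a multiple of the eigenvector
    \<open>v\<close>, so the first column of \<open>B\<close> is \<open>a\<close> times that of
    \<open>W\<^sup>T * W = 1\<^sub>m n\<close>.\<close>
  have B0: "B $$ (i, 0) = (if i = 0 then a else 0)" if i: "i < n" for i
  proof -
    have "B = W\<^sup>T * (A * W)" unfolding B_def using W A WT by (simp add: assoc_mult_mat[of _ n n _ n _ n])
    then have "B $$ (i, 0) = row W\<^sup>T i \<bullet> col (A * W) 0" using i n W A by simp
    also have "col (A * W) 0 = A *\<^sub>v col W 0" using n W A by (intro col_mult2) auto
    also have "\<dots> = a \<cdot>\<^sub>v col W 0"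
      unfolding W0 using A v by (simp add: mult_mat_vec[of _ n n] smult_smult_assoc mult.commute)
    also have "row W\<^sup>T i \<bullet> (a \<cdot>\<^sub>v col W 0) = a * (W\<^sup>T * W) $$ (i, 0)"
      using i n W by simp
    finally show ?thesis using i n by (simp add: WW)
  qed
  have B0': "B $$ (0, i) = (if i = 0 then a else 0)" if i: "i < n" for i
    using B0[OF i] arg_cong[OF Bsym, of "\<lambda>M. M $$ (i, 0)"] i B n by auto
  define C where "C = mat m m (\<lambda>(i, j). B $$ (Suc i, Suc j))"
  have C: "C \<in> carrier_mat m m" by (simp add: C_def)
  define a1 where "a1 = mat 1 1 (\<lambda>_. a)"
  have a1: "a1 \<in> carrier_mat 1 1" by (simp add: a1_def)
  have blockB: "B = four_block_mat a1 (0\<^sub>m 1 m) (0\<^sub>m m 1) C"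
  proof (rule eq_matI)
    fix i j assume "i < dim_row (four_block_mat a1 (0\<^sub>m 1 m) (0\<^sub>m m 1) C)"
      "j < dim_col (four_block_mat a1 (0\<^sub>m 1 m) (0\<^sub>m m 1) C)"
    then have ij: "i < n" "j < n" using n C a1 by auto
    then show "B $$ (i, j) = four_block_mat a1 (0\<^sub>m 1 m) (0\<^sub>m m 1) C $$ (i, j)"
      using B0[OF ij(1)] B0'[OF ij(2)] n by (cases i; cases j) (auto simp: a1_def C_def)
  qed (use B C a1 n in auto)
  have "char_poly a1 = [:- a, 1:]"
    by (simp add: a1_def char_poly_defs det_def sign_def)
  then have cpC: "char_poly C = (\<Prod>a\<leftarrow>as. [:- a, 1:])"
    using cpB unfolding blockB char_poly_four_block_zeros_col[OF a1 zero_carrier_mat C]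
    by (metis mult_cancel_left pCons_eq_0_iff zero_neq_one)
  have Csym: "C\<^sup>T = C"
  proof (rule eq_matI)
    fix i j assume "i < dim_row C" "j < dim_col C"
    then show "C\<^sup>T $$ (i, j) = C $$ (i, j)"
      using arg_cong[OF Bsym, of "\<lambda>M. M $$ (Suc i, Suc j)"] B n by (auto simp: C_def)
  qed (auto simp: C_def)
  define D where "D = mat m m (\<lambda>(i, j). if i = j then as ! i else (0 :: real))"
  have D: "D \<in> carrier_mat m m" by (simp add: D_def)
  obtain Q where Q: "Q \<in> carrier_mat m m" and QQ: "Q\<^sup>T * Q = 1\<^sub>m m" and CQ: "C = Q * D * Q\<^sup>T"
    using Cons.IH[OF C Csym cpC] by (auto simp: D_def)
  have QT: "Q\<^sup>T \<in> carrier_mat m m" using Q by simp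
  define D' where "D' = mat n n (\<lambda>(i, j). if i = j then (a # as) ! i else (0 :: real))"
  have blockD: "D' = four_block_mat a1 (0\<^sub>m 1 m) (0\<^sub>m m 1) D"
    by (rule eq_matI) (auto simp: D'_def D_def a1_def n nth_Cons split: nat.splits)
  have D': "D' \<in> carrier_mat n n" by (simp add: D'_def)
  \<comment> \<open>\<open>F\<close> lets the diagonalising matrix of the block \<open>C\<close> act
    on the last \<open>m\<close> coordinates and fixes the split-off eigenvector.\<close>
  define F where "F = four_block_mat (1\<^sub>m 1) (0\<^sub>m 1 m) (0\<^sub>m m 1) Q"
  have F: "F \<in> carrier_mat n n"
    using four_block_carrier_mat[OF one_carrier_mat[of 1] Q] unfolding F_def n plus_1_eq_Suc .
  have FT: "F\<^sup>T \<in> carrier_mat n n" using F by simp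
  have FT': "F\<^sup>T = four_block_mat (1\<^sub>m 1) (0\<^sub>m 1 m) (0\<^sub>m m 1) Q\<^sup>T"
    unfolding F_def
    by (subst transpose_four_block_mat[OF one_carrier_mat zero_carrier_mat zero_carrier_mat Q]) simp
  have "F\<^sup>T * F = four_block_mat (1\<^sub>m 1) (0\<^sub>m 1 m) (0\<^sub>m m 1) (1\<^sub>m m)"
    unfolding FT' unfolding F_def
    by (subst mult_four_block_mat[OF one_carrier_mat zero_carrier_mat zero_carrier_mat QT
          one_carrier_mat zero_carrier_mat zero_carrier_mat Q]) (use Q QT QQ in simp)
  then have FF: "F\<^sup>T * F = 1\<^sub>m n" unfolding n by simp
  have FD: "F * D' = four_block_mat a1 (0\<^sub>m 1 m) (0\<^sub>m m 1) (Q * D)"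
    unfolding F_def blockD
    by (subst mult_four_block_mat[OF one_carrier_mat zero_carrier_mat zero_carrier_mat Q
          a1 zero_carrier_mat zero_carrier_mat D]) (use Q D a1 in simp)
  have "F * D' * F\<^sup>T = four_block_mat a1 (0\<^sub>m 1 m) (0\<^sub>m m 1) (Q * D * Q\<^sup>T)"
    unfolding FT' FD
    by (subst mult_four_block_mat[OF a1 zero_carrier_mat zero_carrier_mat _
          one_carrier_mat zero_carrier_mat zero_carrier_mat QT, of "Q * D"]) (use Q QT D a1 in auto)
  then have FDF: "B = F * D' * F\<^sup>T" unfolding blockB CQ by simp
  define P where "P = W * F"
  have P: "P \<in> carrier_mat n n" using W F by (simp add: P_def)
  have PT: "P\<^sup>T = F\<^sup>T * W\<^sup>T" unfolding P_def using W F by (simp add: transpose_mult)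
  have "P\<^sup>T * P = F\<^sup>T * (W\<^sup>T * W) * F"
    unfolding PT unfolding P_def using W F WT FT by (simp add: assoc_mult_mat[of _ n n _ n _ n])
  then have "P\<^sup>T * P = 1\<^sub>m n" using F FT FF WW by simp
  moreover have "A = P * D' * P\<^sup>T"
    unfolding AB FDF PT unfolding P_def
    using W F WT FT D' by (simp add: assoc_mult_mat[of _ n n _ n _ n])
  ultimately show ?case using P unfolding D'_def by blast
qed

text \<open>The columns of the diagonalising matrix, rewritten as real sums: \<open>e k i\<close> is
  coordinate \<open>i\<close> of eigenvector \<open>k\<close>. Orthonormality comes from
  \<open>P\<^sup>T * P\<close>, completeness from \<open>P * P\<^sup>T\<close>.\<close>

lemma symmetric_mat_eigenbasis:
  fixes A :: "real mat"
  assumes A: "A \<in> carrier_mat n n" and "A\<^sup>T = A"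
    and "char_poly A = (\<Prod>a\<leftarrow>as. [:- a, 1:])"
  obtains e :: "nat \<Rightarrow> nat \<Rightarrow> real" where
    "\<And>k l. k < n \<Longrightarrow> l < n \<Longrightarrow> (\<Sum>i<n. e k i * e l i) = (if k = l then 1 else 0)"
    "\<And>i j. i < n \<Longrightarrow> j < n \<Longrightarrow> (\<Sum>k<n. e k i * e k j) = (if i = j then 1 else 0)"
    "\<And>i j. i < n \<Longrightarrow> j < n \<Longrightarrow> A $$ (i, j) = (\<Sum>k<n. as ! k * e k i * e k j)"
proof -
  define D where "D = mat n n (\<lambda>(i, j). if i = j then as ! i else 0)"
  obtain P where P: "P \<in> carrier_mat n n" and PP: "P\<^sup>T * P = 1\<^sub>m n"
    and AP: "A = P * D * P\<^sup>T"
    using symmetric_mat_diagonalisation[OF assms] unfolding D_def by blast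
  have PT: "P\<^sup>T \<in> carrier_mat n n" using P by simp
  have PP': "P * P\<^sup>T = 1\<^sub>m n" using mat_mult_left_right_inverse[OF PT P PP] .
  have PD: "(P * D) $$ (i, k) = as ! k * P $$ (i, k)" if "i < n" "k < n" for i k
  proof -
    have "(P * D) $$ (i, k) = (\<Sum>l<n. P $$ (i, l) * (if l = k then as ! l else 0))"
      using P that by (auto simp: D_def scalar_prod_def lessThan_atLeast0 intro!: sum.cong)
    also have "\<dots> = (\<Sum>l<n. if l = k then as ! k * P $$ (i, k) else 0)"
      by (rule sum.cong) auto
    finally show ?thesis using that by simp
  qed
  show thesis
  proof (rule that[of "\<lambda>k i. P $$ (i, k)"])
    fix k l assume kl: "k < n" "l < n"
    then have "(P\<^sup>T * P) $$ (k, l) = (\<Sum>i<n. P $$ (i, k) * P $$ (i, l))"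
      using P by (auto simp: scalar_prod_def lessThan_atLeast0 intro!: sum.cong)
    then show "(\<Sum>i<n. P $$ (i, k) * P $$ (i, l)) = (if k = l then 1 else 0)"
      using kl by (simp add: PP)
  next
    fix i j assume ij: "i < n" "j < n"
    then have "(P * P\<^sup>T) $$ (i, j) = (\<Sum>k<n. P $$ (i, k) * P $$ (j, k))"
      using P by (auto simp: scalar_prod_def lessThan_atLeast0 intro!: sum.cong)
    then show "(\<Sum>k<n. P $$ (i, k) * P $$ (j, k)) = (if i = j then 1 else 0)"
      using ij by (simp add: PP')
  next
    fix i j assume ij: "i < n" "j < n"
    then have "(P * D * P\<^sup>T) $$ (i, j) = (\<Sum>k<n. (P * D) $$ (i, k) * P $$ (j, k))"
      using P by (auto simp: D_def scalar_prod_def lessThan_atLeast0 intro!: sum.cong)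
    then show "A $$ (i, j) = (\<Sum>k<n. as ! k * P $$ (i, k) * P $$ (j, k))"
      using ij PD by (simp add: AP)
  qed
qed

section \<open>Quadratic forms in eigencoordinates and homogeneous linear systems\<close>

lemma square_sum:
  fixes x :: "'i \<Rightarrow> 'b :: comm_semiring_1"
  shows "(\<Sum>i\<in>I. x i)\<^sup>2 = (\<Sum>i\<in>I. \<Sum>j\<in>I. x i * x j)"
  by (simp add: power2_eq_square sum_product)

text \<open>Only the order of summation changes, so \<open>e\<close> and \<open>lam\<close> are
  arbitrary. With \<open>lam\<close> the eigenvalues this evaluates the form of the matrix; with
  \<open>lam\<close> constantly 1 and completeness it becomes Parseval's identity.\<close>

lemma eigenbasis_quadratic_form:
  fixes e :: "nat \<Rightarrow> nat \<Rightarrow> real"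
  shows "(\<Sum>i<n. \<Sum>j<n. (\<Sum>k<n. lam k * e k i * e k j) * (x i * x j))
    = (\<Sum>k<n. lam k * (\<Sum>i<n. e k i * x i)\<^sup>2)"
proof -
  have "(\<Sum>i<n. \<Sum>j<n. (\<Sum>k<n. lam k * e k i * e k j) * (x i * x j))
      = (\<Sum>i<n. \<Sum>j<n. \<Sum>k<n. lam k * ((e k i * x i) * (e k j * x j)))"
    by (simp add: sum_distrib_left sum_distrib_right mult_ac)
  also have "\<dots> = (\<Sum>i<n. \<Sum>k<n. \<Sum>j<n. lam k * ((e k i * x i) * (e k j * x j)))"
    by (intro sum.cong refl sum.swap)
  also have "\<dots> = (\<Sum>k<n. \<Sum>i<n. \<Sum>j<n. lam k * ((e k i * x i) * (e k j * x j)))"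
    by (rule sum.swap)
  also have "\<dots> = (\<Sum>k<n. lam k * (\<Sum>i<n. e k i * x i)\<^sup>2)"
    unfolding square_sum by (simp add: sum_distrib_left)
  finally show ?thesis .
qed

lemma eigenbasis_form_value:
  fixes A e :: "nat \<Rightarrow> nat \<Rightarrow> real"
  assumes orth: "\<And>k l. k < n \<Longrightarrow> l < n \<Longrightarrow> (\<Sum>i<n. e k i * e l i) = (if k = l then 1 else 0)"
    and decomp: "\<And>i j. i < n \<Longrightarrow> j < n \<Longrightarrow> A i j = (\<Sum>k<n. lam k * e k i * e k j)"
    and k: "k < n"
  shows "(\<Sum>i<n. \<Sum>j<n. A i j * (e k i * e k j)) = lam k"
proof -
  have "(\<Sum>i<n. \<Sum>j<n. A i j * (e k i * e k j))
      = (\<Sum>i<n. \<Sum>j<n. (\<Sum>l<n. lam l * e l i * e l j) * (e k i * e k j))"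
    by (intro sum.cong refl) (simp add: decomp)
  also have "\<dots> = (\<Sum>l<n. lam l * (\<Sum>i<n. e l i * e k i)\<^sup>2)"
    by (rule eigenbasis_quadratic_form)
  also have "\<dots> = (\<Sum>l<n. if l = k then lam k else 0)"
    by (intro sum.cong refl) (use k in \<open>simp add: orth\<close>)
  finally show ?thesis using k by simp
qed

lemma underdetermined_homogeneous_system:
  fixes f :: "nat \<Rightarrow> 'i \<Rightarrow> 'b :: field"
  assumes S: "finite S" and m: "m < card S"
  obtains x where "\<exists>i\<in>S. x i \<noteq> 0" and "\<And>l. l < m \<Longrightarrow> (\<Sum>i\<in>S. f l i * x i) = 0"
proof -
  define t where "t = card S"
  obtain h where h: "bij_betw h {0..<t} S"
    using ex_bij_betw_nat_finite[OF S] t_def by blast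
  \<comment> \<open>The \<open>m\<close> equations fill the rows before row \<open>m\<close> of a
    square matrix; the zero row \<open>m\<close> makes it singular, and a kernel vector solves the
    system.\<close>
  define A where "A = mat\<^sub>r t t (\<lambda>l. if l = m then 0\<^sub>v t else vec t (\<lambda>j. f l (h j)))"
  have A: "A \<in> carrier_mat t t" by (simp add: A_def)
  have "det A = 0"
    unfolding A_def by (rule det_row_0) (use m t_def in auto)
  then obtain v where v: "v \<in> carrier_vec t" "v \<noteq> 0\<^sub>v t" "A *\<^sub>v v = 0\<^sub>v t"
    using det_0_iff_vec_prod_zero_field[OF A] by blast
  obtain j where j: "j < t" "v $ j \<noteq> 0"
    using v(1,2) by (metis carrier_vecD eq_vecI index_zero_vec)
  define g where "g = inv_into {0..<t} h"
  have g: "g (h i) = i" if "i < t" for i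
    unfolding g_def using h that by (intro inv_into_f_f) (auto simp: bij_betw_def)
  show thesis
  proof (rule that[of "\<lambda>i. v $ g i"])
    show "\<exists>i\<in>S. v $ g i \<noteq> 0"
      using j g h by (intro bexI[of _ "h j"]) (auto simp: bij_betw_def)
  next
    fix l assume l: "l < m"
    then have lt: "l < t" using m t_def by simp
    have "(\<Sum>i\<in>S. f l i * v $ g i) = (\<Sum>j\<in>{0..<t}. f l (h j) * v $ g (h j))"
      by (rule sum.reindex_bij_betw[OF h, symmetric])
    also have "\<dots> = (\<Sum>j\<in>{0..<t}. f l (h j) * v $ j)"
      by (rule sum.cong) (auto simp: g)
    also have "\<dots> = (A *\<^sub>v v) $ l"
      using lt l v(1) by (auto simp: A_def scalar_prod_def intro!: sum.cong)
    finally show "(\<Sum>i\<in>S. f l i * v $ g i) = 0" using v(3) lt by simp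
  qed
qed

section \<open>Signs of the small eigenvalues\<close>

text \<open>Induction on \<open>p + q\<close>: fix a vertex \<open>w\<close> and split the others
  into neighbours and non-neighbours. The larger class has at least half the required size, and
  \<open>w\<close> extends a clique among its neighbours or an independent set among its
  non-neighbours.\<close>

lemma ramsey_clique_or_independent:
  assumes "finite V" and "2 ^ (p + q) \<le> card V" and E: "\<And>u v. E u v \<Longrightarrow> E v u"
  shows "\<exists>S\<subseteq>V. card S = Suc p \<and> (\<forall>u\<in>S. \<forall>v\<in>S. u \<noteq> v \<longrightarrow> E u v) \<or>
                card S = Suc q \<and> (\<forall>u\<in>S. \<forall>v\<in>S. u \<noteq> v \<longrightarrow> \<not> E u v)"
  using assms(1,2)
proof (induction "p + q" arbitrary: p q V)
  case 0
  then have "V \<noteq> {}" by auto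
  then obtain w where "w \<in> V" by blast
  then show ?case using 0 by (intro exI[of _ "{w}"]) auto
next
  case (Suc k p q V)
  have "V \<noteq> {}" using Suc.prems by auto
  then obtain w where w: "w \<in> V" by blast
  show ?case
  proof (cases "p = 0 \<or> q = 0")
    case True
    then show ?thesis using w by (intro exI[of _ "{w}"]) auto
  next
    case False
    then obtain p' q' where pq: "p = Suc p'" "q = Suc q'" by (metis not0_implies_Suc)
    define N where "N = {v \<in> V - {w}. E w v}"
    define N' where "N' = {v \<in> V - {w}. \<not> E w v}"
    have fin: "finite N" "finite N'" using Suc.prems by (auto simp: N_def N'_def)
    have "V = insert w (N \<union> N')" "w \<notin> N \<union> N'" "N \<inter> N' = {}"
      using w by (auto simp: N_def N'_def)
    then have "card V = Suc (card N + card N')"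
      using fin by (metis card_Un_disjoint card_insert_disjoint finite_UnI)
    moreover have "card V \<ge> 2 ^ k + 2 ^ k"
      using Suc.prems(2) Suc.hyps(2)[symmetric] by simp
    \<comment> \<open>The two classes together have at least \<open>2 * 2 ^ k - 1\<close> elements,
      so they cannot both have fewer than \<open>2 ^ k\<close>.\<close>
    ultimately consider "2 ^ k \<le> card N" | "2 ^ k \<le> card N'" by linarith
    then show ?thesis
    proof cases
      case 1
      have k: "k = p' + q" using Suc.hyps(2) pq by simp
      obtain S where S: "S \<subseteq> N"
        "card S = Suc p' \<and> (\<forall>u\<in>S. \<forall>v\<in>S. u \<noteq> v \<longrightarrow> E u v) \<or>
         card S = Suc q \<and> (\<forall>u\<in>S. \<forall>v\<in>S. u \<noteq> v \<longrightarrow> \<not> E u v)"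
        using Suc.hyps(1)[OF k fin(1)] 1 k by auto
      have S': "finite S" "w \<notin> S" "S \<subseteq> V" "\<forall>v\<in>S. E w v \<and> E v w"
        using S(1) fin finite_subset[OF S(1)] E by (auto simp only: N_def subset_iff mem_Collect_eq Diff_iff insert_iff)
      from S(2) show ?thesis
      proof
        assume "card S = Suc p' \<and> (\<forall>u\<in>S. \<forall>v\<in>S. u \<noteq> v \<longrightarrow> E u v)"
        then have "card (insert w S) = Suc p \<and> (\<forall>u\<in>insert w S. \<forall>v\<in>insert w S. u \<noteq> v \<longrightarrow> E u v)"
          using S' pq by simp
        then show ?thesis using S'(3) w by (intro exI[of _ "insert w S"]) blast
      qed (use S' in blast)
    next
      case 2
      have k: "k = p + q'" using Suc.hyps(2) pq by simp
      obtain S where S: "S \<subseteq> N'"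
        "card S = Suc p \<and> (\<forall>u\<in>S. \<forall>v\<in>S. u \<noteq> v \<longrightarrow> E u v) \<or>
         card S = Suc q' \<and> (\<forall>u\<in>S. \<forall>v\<in>S. u \<noteq> v \<longrightarrow> \<not> E u v)"
        using Suc.hyps(1)[OF k fin(2)] 2 k by auto
      have S': "finite S" "w \<notin> S" "S \<subseteq> V" "\<forall>v\<in>S. \<not> E w v \<and> \<not> E v w"
        using S(1) fin finite_subset[OF S(1)] E by (auto simp only: N'_def subset_iff mem_Collect_eq Diff_iff insert_iff)
      from S(2) show ?thesis
      proof
        assume "card S = Suc q' \<and> (\<forall>u\<in>S. \<forall>v\<in>S. u \<noteq> v \<longrightarrow> \<not> E u v)"
        then have "card (insert w S) = Suc q \<and> (\<forall>u\<in>insert w S. \<forall>v\<in>insert w S. u \<noteq> v \<longrightarrow> \<not> E u v)"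
          using S' pq by simp
        then show ?thesis using S'(3) w by (intro exI[of _ "insert w S"]) blast
      qed (use S' in blast)
    qed
  qed
qed

text \<open>The vectors supported on \<open>S\<close> with coordinate sum zero form an \<open>s\<close>-dimensional space on which the
  quadratic form of \<open>A\<close> is nonpositive; it meets the span of the first \<open>n - s + 1\<close> eigenvectors.\<close>

lemma eigenvalue_nonpos_if_constant_block:
  fixes A e :: "nat \<Rightarrow> nat \<Rightarrow> real"
  assumes complete: "\<And>i j. i < n \<Longrightarrow> j < n \<Longrightarrow> (\<Sum>k<n. e k i * e k j) = (if i = j then 1 else 0)"
    and decomp: "\<And>i j. i < n \<Longrightarrow> j < n \<Longrightarrow> A i j = (\<Sum>k<n. lam k * e k i * e k j)"
    and S: "S \<subseteq> {..<n}" "card S = Suc s"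
    and diag: "\<And>i. i \<in> S \<Longrightarrow> A i i = 0"
    and const: "\<And>i j. i \<in> S \<Longrightarrow> j \<in> S \<Longrightarrow> i \<noteq> j \<Longrightarrow> A i j = c" and c: "0 \<le> c"
    and large: "\<And>k. k \<le> n - s \<Longrightarrow> \<theta> \<le> lam k" and s: "1 \<le> s" "s \<le> n"
  shows "\<theta> \<le> 0"
proof (rule ccontr)
  assume "\<not> \<theta> \<le> 0"
  then have pos: "0 < lam k" if "k \<le> n - s" for k using large[OF that] by linarith
  have finS: "finite S" using S(1) finite_subset by blast
  \<comment> \<open>There are \<open>s\<close> equations in \<open>s + 1\<close> unknowns: equation
    0 is the vanishing coordinate sum, and the other \<open>s - 1\<close> are orthogonality to the
    eigenvectors at positions \<open>n - s + 1\<close> to \<open>n - 1\<close>.\<close>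
  obtain x where x: "\<exists>i\<in>S. x i \<noteq> 0"
    and x0: "\<And>l. l < s \<Longrightarrow> (\<Sum>i\<in>S. (if l = 0 then 1 else e (n - s + l) i) * x i) = 0"
    by (rule underdetermined_homogeneous_system[OF finS, of s "\<lambda>l i. if l = 0 then 1 else e (n - s + l) i"])
      (use S(2) in auto)
  define y where "y i = (if i \<in> S then x i else 0)" for i
  have sumS: "(\<Sum>i<n. g i * y i) = (\<Sum>i\<in>S. g i * x i)" for g :: "nat \<Rightarrow> real"
    by (rule sum.mono_neutral_cong_right) (use S in \<open>auto simp: y_def\<close>)
  define z where "z k = (\<Sum>i<n. e k i * y i)" for k
  have z0: "z k = 0" if "n - s < k" "k < n" for k
    using x0[of "k - (n - s)"] that s by (simp add: z_def sumS less_diff_conv2)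
  have "(\<Sum>k<n. 1 * (z k)\<^sup>2) = (\<Sum>i<n. \<Sum>j<n. (\<Sum>k<n. 1 * e k i * e k j) * (y i * y j))"
    unfolding z_def by (rule eigenbasis_quadratic_form[symmetric])
  also have "\<dots> = (\<Sum>i<n. \<Sum>j<n. (if i = j then y i * y j else 0))"
    by (intro sum.cong refl) (auto simp: complete)
  also have "\<dots> = (\<Sum>i<n. (y i)\<^sup>2)"
    by (intro sum.cong refl) (simp add: power2_eq_square)
  finally have norm: "(\<Sum>k<n. (z k)\<^sup>2) = (\<Sum>i<n. (y i)\<^sup>2)" by simp
  have "0 < (\<Sum>i<n. (y i)\<^sup>2)"
  proof -
    obtain i where "i \<in> S" "x i \<noteq> 0" using x by blast
    then show ?thesis using S(1) by (intro sum_pos2[of _ i]) (auto simp: y_def)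
  qed
  then have "\<exists>k<n. z k \<noteq> 0"
    unfolding norm[symmetric] by (intro ccontr[of "\<exists>k<n. z k \<noteq> 0"]) simp
  then obtain k where k: "k < n" "z k \<noteq> 0" by blast
  \<comment> \<open>The coefficients \<open>z k\<close> vanish beyond position \<open>n - s\<close>,
    and up to there every eigenvalue is positive.\<close>
  have "0 < (\<Sum>k<n. lam k * (z k)\<^sup>2)"
  proof (rule sum_pos2[of _ k])
    show "0 < lam k * (z k)\<^sup>2" using pos[of k] z0[of k] k by (cases "k \<le> n - s") auto
    show "0 \<le> lam k * (z k)\<^sup>2" if "k \<in> {..<n}" for k
      using pos[of k] z0[of k] that by (cases "k \<le> n - s") auto
  qed (use k in auto)
  also have "(\<Sum>k<n. lam k * (z k)\<^sup>2)
      = (\<Sum>i<n. \<Sum>j<n. (\<Sum>k<n. lam k * e k i * e k j) * (y i * y j))"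
    unfolding z_def by (rule eigenbasis_quadratic_form[symmetric])
  \<comment> \<open>On \<open>S\<close> the matrix is \<open>c\<close> times all-ones minus
    identity, and \<open>y\<close> vanishes elsewhere. As the coordinate sum is zero, only minus
    \<open>c\<close> times the squared norm survives, contradicting positivity.\<close>
  also have "\<dots> = (\<Sum>i<n. \<Sum>j<n. c * (y i * y j) - (if i = j then c * (y i * y j) else 0))"
  proof (intro sum.cong refl)
    fix i j assume "i \<in> {..<n}" "j \<in> {..<n}"
    then have "(\<Sum>k<n. lam k * e k i * e k j) = A i j" by (simp add: decomp)
    then show "(\<Sum>k<n. lam k * e k i * e k j) * (y i * y j)
        = c * (y i * y j) - (if i = j then c * (y i * y j) else 0)"
      using diag[of i] const[of i j] by (auto simp: y_def)
  qed
  also have "\<dots> = c * (\<Sum>i<n. 1 * y i)\<^sup>2 - c * (\<Sum>i<n. (y i)\<^sup>2)"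
    unfolding square_sum by (simp add: sum_subtractf sum_distrib_left power2_eq_square)
  also have "(\<Sum>i<n. 1 * y i) = 0"
    using x0[of 0] s unfolding sumS by simp
  finally show False
    using mult_nonneg_nonneg[OF c sum_nonneg[of "{..<n}" "\<lambda>i. (y i)\<^sup>2"]] by simp
qed

section \<open>The trace inequality\<close>

text \<open>The Frobenius product of two sums of rank-one matrices. Its being a sum of squares is
  why the trace of a product of two projections is nonnegative.\<close>

lemma sum_prod_rank_one_sums:
  fixes u v :: "'k \<Rightarrow> 'i \<Rightarrow> real"
  shows "(\<Sum>i\<in>I. \<Sum>j\<in>I. (\<Sum>k\<in>K. u k i * u k j) * (\<Sum>l\<in>L. v l i * v l j))
    = (\<Sum>k\<in>K. \<Sum>l\<in>L. (\<Sum>i\<in>I. u k i * v l i)\<^sup>2)"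
proof -
  have "(\<Sum>i\<in>I. \<Sum>j\<in>I. (\<Sum>k\<in>K. u k i * u k j) * (\<Sum>l\<in>L. v l i * v l j))
      = (\<Sum>(i, j)\<in>I \<times> I. \<Sum>(k, l)\<in>K \<times> L. (u k i * v l i) * (u k j * v l j))"
    by (simp add: sum_product sum.cartesian_product[symmetric] mult_ac)
  also have "\<dots> = (\<Sum>(k, l)\<in>K \<times> L. \<Sum>(i, j)\<in>I \<times> I. (u k i * v l i) * (u k j * v l j))"
    unfolding case_prod_unfold by (rule sum.swap)
  also have "\<dots> = (\<Sum>k\<in>K. \<Sum>l\<in>L. (\<Sum>i\<in>I. u k i * v l i)\<^sup>2)"
    by (simp add: power2_eq_square sum_product sum.cartesian_product[symmetric])
  finally show ?thesis .
qed

lemma sum_rank_one_form: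
  fixes M :: "'i \<Rightarrow> 'i \<Rightarrow> real" and u :: "'k \<Rightarrow> 'i \<Rightarrow> real"
  shows "(\<Sum>i\<in>I. \<Sum>j\<in>I. M i j * (\<Sum>k\<in>K. u k i * u k j))
    = (\<Sum>k\<in>K. \<Sum>i\<in>I. \<Sum>j\<in>I. M i j * (u k i * u k j))"
proof -
  have "(\<Sum>i\<in>I. \<Sum>j\<in>I. M i j * (\<Sum>k\<in>K. u k i * u k j))
      = (\<Sum>(i, j)\<in>I \<times> I. \<Sum>k\<in>K. M i j * (u k i * u k j))"
    by (simp add: sum_distrib_left sum.cartesian_product[symmetric])
  also have "\<dots> = (\<Sum>k\<in>K. \<Sum>(i, j)\<in>I \<times> I. M i j * (u k i * u k j))"
    unfolding case_prod_unfold by (rule sum.swap)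
  finally show ?thesis by (simp add: sum.cartesian_product[symmetric])
qed

text \<open>Cauchy-Schwarz for \<open>M\<close> and the difference of the projections
  \<open>V\<close> and \<open>U\<close>, viewed as vectors indexed by pairs. Each projection has
  squared norm \<open>card K\<close>, and their inner product is nonnegative, so the squared norm of
  the difference is at most \<open>2 * card K\<close>; that of \<open>M\<close> is at most
  \<open>n\<close> squared.\<close>

lemma form_gap_bound:
  fixes M u v :: "nat \<Rightarrow> nat \<Rightarrow> real"
  assumes M: "\<And>i j. i < n \<Longrightarrow> j < n \<Longrightarrow> \<bar>M i j\<bar> \<le> 1"
    and K: "finite K"
    and u: "\<And>k l. k \<in> K \<Longrightarrow> l \<in> K \<Longrightarrow> (\<Sum>i<n. u k i * u l i) = (if k = l then 1 else 0)"
    and v: "\<And>k l. k \<in> K \<Longrightarrow> l \<in> K \<Longrightarrow> (\<Sum>i<n. v k i * v l i) = (if k = l then 1 else 0)"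
    and upper: "\<And>k. k \<in> K \<Longrightarrow> (\<Sum>i<n. \<Sum>j<n. M i j * (u k i * u k j)) \<le> \<alpha>"
    and lower: "\<And>k. k \<in> K \<Longrightarrow> \<beta> \<le> (\<Sum>i<n. \<Sum>j<n. M i j * (v k i * v k j))"
  shows "real (card K) * (\<beta> - \<alpha>) \<le> real n * sqrt (2 * real (card K))"
proof -
  define U where "U i j = (\<Sum>k\<in>K. u k i * u k j)" for i j
  define V where "V i j = (\<Sum>k\<in>K. v k i * v k j)" for i j
  let ?I = "{..<n} \<times> {..<n}"
  define X where "X = (\<lambda>(i, j). V i j - U i j)"
  define m where "m = (\<lambda>(i, j). M i j)"
  have orth_sum: "(\<Sum>k\<in>K. \<Sum>l\<in>K. (\<Sum>i<n. w k i * w l i)\<^sup>2) = real (card K)"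
    if "\<And>k l. k \<in> K \<Longrightarrow> l \<in> K \<Longrightarrow> (\<Sum>i<n. w k i * w l i) = (if k = l then 1 else 0)"
    for w :: "nat \<Rightarrow> nat \<Rightarrow> real"
  proof -
    have "(\<Sum>k\<in>K. \<Sum>l\<in>K. (\<Sum>i<n. w k i * w l i)\<^sup>2) = (\<Sum>k\<in>K. \<Sum>l\<in>K. if k = l then 1 else 0)"
      by (intro sum.cong refl) (simp add: that)
    then show ?thesis using K by simp
  qed
  have UU: "(\<Sum>i<n. \<Sum>j<n. U i j * U i j) = real (card K)"
    unfolding U_def sum_prod_rank_one_sums using orth_sum u by blast
  have VV: "(\<Sum>i<n. \<Sum>j<n. V i j * V i j) = real (card K)"
    unfolding V_def sum_prod_rank_one_sums using orth_sum v by blast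
  have UV: "0 \<le> (\<Sum>i<n. \<Sum>j<n. U i j * V i j)"
    unfolding U_def V_def sum_prod_rank_one_sums by (intro sum_nonneg) simp
  have "(\<Sum>a\<in>?I. (X a)\<^sup>2) = (\<Sum>i<n. \<Sum>j<n. V i j * V i j + U i j * U i j - 2 * (U i j * V i j))"
    by (auto simp: X_def sum.cartesian_product power2_eq_square algebra_simps intro!: sum.cong)
  also have "\<dots> = 2 * real (card K) - 2 * (\<Sum>i<n. \<Sum>j<n. U i j * V i j)"
    using UU VV by (simp add: sum.distrib sum_subtractf sum_distrib_left)
  finally have X2: "(\<Sum>a\<in>?I. (X a)\<^sup>2) \<le> 2 * real (card K)" using UV by simp
  have "(\<Sum>a\<in>?I. (m a)\<^sup>2) \<le> (\<Sum>a\<in>?I. 1)"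
    by (rule sum_mono) (use M in \<open>auto simp: m_def abs_square_le_1\<close>)
  then have m2: "(\<Sum>a\<in>?I. (m a)\<^sup>2) \<le> (real n)\<^sup>2" by (simp add: power2_eq_square)
  have "(\<Sum>a\<in>?I. m a * X a) = (\<Sum>i<n. \<Sum>j<n. M i j * V i j) - (\<Sum>i<n. \<Sum>j<n. M i j * U i j)"
    by (simp add: m_def X_def sum.cartesian_product[symmetric] right_diff_distrib sum_subtractf
        case_prod_unfold) (simp add: sum.cartesian_product case_prod_unfold)
  moreover have "(\<Sum>k\<in>K. \<beta>) \<le> (\<Sum>i<n. \<Sum>j<n. M i j * V i j)"
    unfolding V_def sum_rank_one_form by (rule sum_mono) (rule lower)
  moreover have "(\<Sum>i<n. \<Sum>j<n. M i j * U i j) \<le> (\<Sum>k\<in>K. \<alpha>)"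
    unfolding U_def sum_rank_one_form by (rule sum_mono) (rule upper)
  ultimately have "real (card K) * (\<beta> - \<alpha>) \<le> (\<Sum>a\<in>?I. m a * X a)"
    by (simp add: right_diff_distrib)
  also have "\<dots> \<le> sqrt ((\<Sum>a\<in>?I. (m a)\<^sup>2) * (\<Sum>a\<in>?I. (X a)\<^sup>2))"
    by (intro real_le_rsqrt Cauchy_Schwarz_ineq_sum)
  also have "\<dots> \<le> sqrt ((real n)\<^sup>2 * (2 * real (card K)))"
    by (intro real_sqrt_le_mono mult_mono m2 X2) (auto intro: sum_nonneg)
  also have "\<dots> = real n * sqrt (2 * real (card K))" by (simp add: real_sqrt_mult)
  finally show ?thesis .
qed

section \<open>Graph spectra\<close>

lemma adjacency_mat_nth:
  assumes "i < length (vertex_enum G)" and "j < length (vertex_enum G)"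
  shows "adjacency_mat G $$ (i, j)
    = (if (vertex_enum G ! i, vertex_enum G ! j) \<in> parcs G then 1 else 0)"
  using assms by (simp add: adjacency_mat_def adjacency_mat_wrt_def)

lemma adjacency_mat_diag:
  assumes "pair_graph G" and "i < card (pverts G)"
  shows "adjacency_mat G $$ (i, i) = 0"
proof -
  interpret pair_graph G by fact
  show ?thesis
    using assms(2) vertex_enum(3)[OF pair_finite_verts]
    by (auto simp: adjacency_mat_nth dest: pair_no_loops)
qed

lemma transpose_adjacency_mat:
  assumes "pair_graph G"
  shows "(adjacency_mat G)\<^sup>T = adjacency_mat G"
proof -
  interpret pair_graph G by fact
  have "sym (parcs G)" using pair_sym_arcs by (simp add: symmetric_def)
  then show ?thesis
    by (intro eq_matI) (auto simp: adjacency_mat_def adjacency_mat_wrt_def sym_def)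
qed

lemma adjacency_mat_complement_nth:
  assumes "finite (pverts G)" and ij: "i < card (pverts G)" "j < card (pverts G)"
  shows "adjacency_mat (complement_graph G) $$ (i, j)
    = 1 - (if i = j then 1 else 0) - (if i = j then 0 else adjacency_mat G $$ (i, j))"
proof -
  note enum = vertex_enum[OF assms(1)]
  \<comment> \<open>The enumeration is chosen from the vertex set alone, so both graphs get the same
    list and their matrices can be compared entry by entry.\<close>
  have enum_eq: "vertex_enum (complement_graph G) = vertex_enum G"
    by (simp add: vertex_enum_def complement_graph_def)
  have "vertex_enum G ! i \<in> pverts G" "vertex_enum G ! j \<in> pverts G"
    using enum ij by (metis nth_mem)+
  moreover have "vertex_enum G ! i = vertex_enum G ! j \<longleftrightarrow> i = j"
    using enum ij by (simp add: nth_eq_iff_index_eq)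
  ultimately show ?thesis
    using ij enum(3) by (simp add: adjacency_mat_nth enum_eq) (auto simp: complement_graph_def)
qed

lemma graph_spectrum_antimono:
  assumes "i \<le> j" and "j < length (graph_spectrum G)"
  shows "graph_spectrum G ! j \<le> graph_spectrum G ! i"
  using assms by (intro sorted_rev_nth_mono) (auto simp: graph_spectrum_def)

text \<open>The spectrum lists as many roots as the degree of the characteristic polynomial, hence
  factors it. The eigenvectors are numbered along the non-increasing spectrum, from position
  0.\<close>

lemma graph_eigenbasis:
  assumes G: "pair_graph G" and n: "card (pverts G) = n"
  obtains e :: "nat \<Rightarrow> nat \<Rightarrow> real" where
    "\<And>k l. k < n \<Longrightarrow> l < n \<Longrightarrow> (\<Sum>i<n. e k i * e l i) = (if k = l then 1 else 0)"
    "\<And>i j. i < n \<Longrightarrow> j < n \<Longrightarrow> (\<Sum>k<n. e k i * e k j) = (if i = j then 1 else 0)"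
    "\<And>i j. i < n \<Longrightarrow> j < n \<Longrightarrow>
      adjacency_mat G $$ (i, j) = (\<Sum>k<n. graph_spectrum G ! k * e k i * e k j)"
proof -
  interpret pair_graph G by fact
  have A: "adjacency_mat G \<in> carrier_mat n n"
    using adjacency_mat_carrier[OF pair_finite_verts] n by simp
  have "char_poly (adjacency_mat G) = (\<Prod>a\<leftarrow>graph_spectrum G. [:- a, 1:])"
  proof (rule monic_eq_prod_list_proots)
    show "mset (graph_spectrum G) = proots (char_poly (adjacency_mat G))"
      by (simp add: graph_spectrum_def)
  qed (use degree_monic_char_poly[OF A] length_graph_spectrum[OF G] n in auto)
  from symmetric_mat_eigenbasis[OF A transpose_adjacency_mat[OF G] this] that
  show thesis by blast
qed

text \<open>Ramsey with both parameters equal to \<open>s\<close> applies since 4^s = 2^(s+s). A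
  clique gives a block with constant 1 off the diagonal, an independent set one with constant 0, and
  either suffices.\<close>

lemma small_graph_eigenvalue_nonpos:
  assumes G: "pair_graph G" and n: "card (pverts G) = n" and s: "1 \<le> s" "4 ^ s \<le> n"
  shows "\<mu>\<^bsub>n - s + 1\<^esub> G \<le> 0"
proof -
  interpret pair_graph G by fact
  note enum = vertex_enum[OF pair_finite_verts]
  define A where "A i j = adjacency_mat G $$ (i, j)" for i j
  have "s < 4 ^ s" by (induction s) auto
  then have sn: "s \<le> n" using s by simp
  have A01: "A i j = 1 \<or> A i j = 0" if "i < n" "j < n" for i j
    using that enum(3) n by (auto simp: A_def adjacency_mat_nth)
  have A0: "A i i = 0" if "i < n" for i
    using that adjacency_mat_diag[OF G] n by (simp add: A_def)
  obtain e where e: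
    "\<And>k l. k < n \<Longrightarrow> l < n \<Longrightarrow> (\<Sum>i<n. e k i * e l i) = (if k = l then 1 else 0)"
    "\<And>i j. i < n \<Longrightarrow> j < n \<Longrightarrow> (\<Sum>k<n. e k i * e k j) = (if i = j then 1 else 0)"
    "\<And>i j. i < n \<Longrightarrow> j < n \<Longrightarrow> A i j = (\<Sum>k<n. graph_spectrum G ! k * e k i * e k j)"
    using graph_eigenbasis[OF G n] unfolding A_def by blast
  \<comment> \<open>The index bounds make \<open>E\<close> symmetric on all natural numbers, as the
    Ramsey lemma demands.\<close>
  define E where "E i j \<longleftrightarrow> i < n \<and> j < n \<and> A i j = 1" for i j
  have "E j i" if "E i j" for i j
    using that arg_cong[OF transpose_adjacency_mat[OF G], of "\<lambda>M. M $$ (i, j)"]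
      adjacency_mat_carrier[OF pair_finite_verts] n by (auto simp: E_def A_def)
  moreover have "2 ^ (s + s) \<le> card {..<n}"
    using s by (simp add: power_add power_mult_distrib[symmetric])
  ultimately obtain S where S: "S \<subseteq> {..<n}"
    "card S = Suc s \<and> (\<forall>u\<in>S. \<forall>v\<in>S. u \<noteq> v \<longrightarrow> E u v) \<or>
     card S = Suc s \<and> (\<forall>u\<in>S. \<forall>v\<in>S. u \<noteq> v \<longrightarrow> \<not> E u v)"
    using ramsey_clique_or_independent[of "{..<n}" s s E] by auto
  have "\<exists>c\<ge>0. \<forall>u\<in>S. \<forall>v\<in>S. u \<noteq> v \<longrightarrow> A u v = c"
    using S(2)
  proof
    assume "card S = Suc s \<and> (\<forall>u\<in>S. \<forall>v\<in>S. u \<noteq> v \<longrightarrow> E u v)"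
    then show ?thesis by (intro exI[of _ 1]) (auto simp: E_def)
  next
    assume "card S = Suc s \<and> (\<forall>u\<in>S. \<forall>v\<in>S. u \<noteq> v \<longrightarrow> \<not> E u v)"
    then have "A u v = 0" if "u \<in> S" "v \<in> S" "u \<noteq> v" for u v
      using S(1) A01[of u v] that by (auto simp: E_def subset_iff)
    then show ?thesis by (intro exI[of _ 0]) auto
  qed
  then obtain c where c: "0 \<le> c" "\<And>u v. u \<in> S \<Longrightarrow> v \<in> S \<Longrightarrow> u \<noteq> v \<Longrightarrow> A u v = c"
    by blast
  have "graph_spectrum G ! (n - s) \<le> 0"
  proof (rule eigenvalue_nonpos_if_constant_block[OF e(2,3) S(1) _ _ c(2,1) _ s(1) sn])
    show "card S = Suc s" using S(2) by blast
    show "A i i = 0" if "i \<in> S" for i using A0 S(1) that by auto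
    show "graph_spectrum G ! (n - s) \<le> graph_spectrum G ! k" if "k \<le> n - s" for k
      using that s sn length_graph_spectrum[OF G] n by (intro graph_spectrum_antimono) auto
  qed
  then show ?thesis by (simp add: graph_eigenvalue_def)
qed

section \<open>Comparing the two spectra through a matrix of signs\<close>

theorem theorem8:
  fixes G :: "'a pair_pre_digraph" and n s :: nat
  assumes "pair_graph G" and "card (pverts G) = n"
    and "s \<ge> 1" and "n \<ge> 4 ^ s"
  shows "\<bar>\<mu>\<^bsub>n - s + 1\<^esub> G\<bar> + \<bar>\<mu>\<^bsub>n - s + 1\<^esub> (complement_graph G)\<bar>
           \<le> real n / sqrt (2 * real s) + 1"
proof -
  interpret pair_graph G by fact
  note G = assms(1) and n = assms(2) and s = assms(3,4)
  let ?H = "complement_graph G"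
  have H: "pair_graph ?H" using pair_graph_complement_graph[OF G] .
  have nH: "card (pverts ?H) = n" using n by (simp add: complement_graph_def)
  \<comment> \<open>This keeps the natural-number subtraction \<open>n - s\<close> from being
    truncated.\<close>
  have "s < 4 ^ s" by (induction s) auto
  then have sn: "s \<le> n" using s by simp
  define A where "A i j = adjacency_mat G $$ (i, j)" for i j
  define B where "B i j = adjacency_mat ?H $$ (i, j)" for i j
  define \<theta> where "\<theta> = \<mu>\<^bsub>n - s + 1\<^esub> G"
  define \<theta>' where "\<theta>' = \<mu>\<^bsub>n - s + 1\<^esub> ?H"
  have A01: "A i j = 1 \<or> A i j = 0" if "i < n" "j < n" for i j
    using that vertex_enum(3)[OF pair_finite_verts] n by (auto simp: A_def adjacency_mat_nth)
  have A0: "A i i = 0" if "i < n" for i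
    using that adjacency_mat_diag[OF G] n by (simp add: A_def)
  have AB: "A i j = 1 - (if i = j then 1 else 0) - B i j" if "i < n" "j < n" for i j
    using adjacency_mat_complement_nth[OF pair_finite_verts, of i j] A0[of i] that n
    by (auto simp: A_def B_def)
  obtain u where u:
    "\<And>k l. k < n \<Longrightarrow> l < n \<Longrightarrow> (\<Sum>i<n. u k i * u l i) = (if k = l then 1 else 0)"
    "\<And>i j. i < n \<Longrightarrow> j < n \<Longrightarrow> (\<Sum>k<n. u k i * u k j) = (if i = j then 1 else 0)"
    "\<And>i j. i < n \<Longrightarrow> j < n \<Longrightarrow> A i j = (\<Sum>k<n. graph_spectrum G ! k * u k i * u k j)"
    by (rule graph_eigenbasis[OF G n, folded A_def]) blast
  obtain v where v:
    "\<And>k l. k < n \<Longrightarrow> l < n \<Longrightarrow> (\<Sum>i<n. v k i * v l i) = (if k = l then 1 else 0)"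
    "\<And>i j. i < n \<Longrightarrow> j < n \<Longrightarrow> (\<Sum>k<n. v k i * v k j) = (if i = j then 1 else 0)"
    "\<And>i j. i < n \<Longrightarrow> j < n \<Longrightarrow> B i j = (\<Sum>k<n. graph_spectrum ?H ! k * v k i * v k j)"
    by (rule graph_eigenbasis[OF H nH, folded B_def]) blast
  \<comment> \<open>These are the list positions of the \<open>s\<close> smallest eigenvalues;
    position \<open>n - s\<close>, counted from 0, carries \<theta> and \<theta>'
    themselves.\<close>
  define K where "K = {n - s..<n}"
  have K: "finite K" "card K = s" "\<And>k. k \<in> K \<Longrightarrow> k < n" using sn by (auto simp: K_def)
  have \<theta>_ge: "graph_spectrum G ! k \<le> \<theta>" "graph_spectrum ?H ! k \<le> \<theta>'" if "k \<in> K" for k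
    using that n nH length_graph_spectrum[OF G] length_graph_spectrum[OF H]
    by (auto simp: \<theta>_def \<theta>'_def graph_eigenvalue_def K_def intro!: graph_spectrum_antimono)
  have "real (card K) * ((- 2 - 2 * \<theta>') - 2 * \<theta>) \<le> real n * sqrt (2 * real (card K))"
  proof (rule form_gap_bound[of n "\<lambda>i j. 2 * A i j - 1" K u v])
    show "\<bar>2 * A i j - 1\<bar> \<le> 1" if "i < n" "j < n" for i j using A01[OF that] by auto
  next
    fix k assume k: "k \<in> K"
    have "(\<Sum>i<n. \<Sum>j<n. (2 * A i j - 1) * (u k i * u k j))
        = 2 * (\<Sum>i<n. \<Sum>j<n. A i j * (u k i * u k j)) - (\<Sum>i<n. \<Sum>j<n. u k i * u k j)"
      by (simp only: left_diff_distrib sum_subtractf sum_distrib_left mult.assoc mult_1_left)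
    also have "\<dots> = 2 * graph_spectrum G ! k - (\<Sum>i<n. u k i)\<^sup>2"
      by (simp only: square_sum eigenbasis_form_value[OF u(1,3) K(3)[OF k]])
    finally show "(\<Sum>i<n. \<Sum>j<n. (2 * A i j - 1) * (u k i * u k j)) \<le> 2 * \<theta>"
      using \<theta>_ge(1)[OF k] zero_le_power2[of "\<Sum>i<n. u k i"] by linarith
  next
    fix k assume k: "k \<in> K"
    have "(\<Sum>i<n. \<Sum>j<n. (2 * A i j - 1) * (v k i * v k j))
        = (\<Sum>i<n. \<Sum>j<n. v k i * v k j - (if i = j then 2 * (v k i * v k j) else 0)
            - 2 * (B i j * (v k i * v k j)))"
      by (intro sum.cong refl) (auto simp: AB algebra_simps)
    also have "\<dots> = (\<Sum>i<n. \<Sum>j<n. v k i * v k j) - 2 * (\<Sum>i<n. v k i * v k i)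
        - 2 * (\<Sum>i<n. \<Sum>j<n. B i j * (v k i * v k j))"
    proof -
      have "(\<Sum>i<n. \<Sum>j<n. (if i = j then 2 * (v k i * v k j) else 0)) = 2 * (\<Sum>i<n. v k i * v k i)"
        unfolding sum_distrib_left by (intro sum.cong refl) simp
      then show ?thesis by (simp only: sum_subtractf sum_distrib_left)
    qed
    also have "\<dots> = (\<Sum>i<n. v k i)\<^sup>2 - 2 - 2 * graph_spectrum ?H ! k"
      using v(1) K(3)[OF k] by (simp add: square_sum eigenbasis_form_value[OF v(1,3) K(3)[OF k]])
    finally show "- 2 - 2 * \<theta>' \<le> (\<Sum>i<n. \<Sum>j<n. (2 * A i j - 1) * (v k i * v k j))"
      using \<theta>_ge(2)[OF k] zero_le_power2[of "\<Sum>i<n. v k i"] by linarith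
  qed (use K u(1) v(1) in simp_all)
  \<comment> \<open>The left side of the gap bound is \<open>2 * s\<close> times
    \<open>- \<theta> - \<theta>' - 1\<close>; writing \<open>2 * s\<close> as a square lets one
    factor \<open>sqrt (2 * s)\<close> cancel.\<close>
  then have "sqrt (2 * real s) * (sqrt (2 * real s) * (- \<theta> - \<theta>' - 1))
      \<le> sqrt (2 * real s) * real n"
    unfolding K(2) mult.assoc[symmetric] by (simp add: algebra_simps)
  then have "- \<theta> - \<theta>' - 1 \<le> real n / sqrt (2 * real s)"
    using s(1) by (simp add: pos_le_divide_eq mult.commute)
  \<comment> \<open>The signs turn the absolute values into \<open>- \<theta>\<close> and
    \<open>- \<theta>'\<close>.\<close>
  moreover have "\<theta> \<le> 0" "\<theta>' \<le> 0"
    using small_graph_eigenvalue_nonpos G n H nH s unfolding \<theta>_def \<theta>'_def by blast+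
  ultimately show ?thesis unfolding \<theta>_def \<theta>'_def by simp
qed

end
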